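(* Let $G=(B,\circ)$ be a group with identity $0$ and let $\sigma:B\to B^B$ be an affine structure on $G$. Then the binary operation on $B$ given by $a+b:=a\circ\sigma_a(b)$, for all $a,b\in B$, makes $(B,+,\circ)$ into a semi-brace (denoted $B_\sigma$). Moreover, if $\sigma$ is cancellative, then $B_\sigma$ is a left cancellative semi-brace. If in addition $\sigma$ is groupal, then $B_\sigma$ is a skew brace.
   Context: For a group $G=(B,\circ)$, $0$ denotes its identity and $a^-$ the inverse of $a$. $B^B$ is the monoid (under composition) of all maps $B\to B$ and $\mathrm{Sym}_B$ is the symmetric group on $B$. For $\sigma:B\to B^B$ write $\sigma_a:=\sigma(a)$; juxtaposition of maps is composition. An affine structure on $G$ is a map $\sigma:B\to B^B$ that is a semigroup anti-homomorphism, i.e. $\sigma_{a\circ b}=\sigma_b\sigma_a$ for all $a,b\in B$ (it is not required that $\sigma_0=\mathrm{id}_B$), such that $\sigma_a(b\circ\sigma_b(c))=\sigma_a(b)\circ\sigma_{\sigma_a(b)}\sigma_a(c)$ for all $a,b,c\in B$. It is cancellative if $\sigma(B)\subseteq \mathrm{Sym}_B$, and groupal if it is cancellative and $\sigma_a(0)=0$ for every $a\in B$. A (left) semi-brace is a set $B$ with two binary operations $+,\circ$ such that $(B,+)$ is a semigroup, $(B,\circ)$ is a group, and $a\circ(b+c)=a\circ b+a\circ(a^-+c)$ for all $a,b,c\in B$ ($\circ$ has higher precedence than $+$). It is left cancellative if the semigroup $(B,+)$ is left cancellative; it is a skew brace if $(B,+)$ is a group. *)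

theory Defs
  imports "HOL-Algebra.Group"
begin

text \<open>
  Maps \<open>B \<rightarrow> B\<close> are represented by HOL functions constrained only on the carrier \<open>B\<close>, so equality
  of maps (and composition) is expressed pointwise on the carrier.
\<close>

locale affine_structure = group G for G (structure) +
  fixes \<sigma> :: "'a \<Rightarrow> 'a \<Rightarrow> 'a"
  assumes affine_closed: "\<sigma> \<in> carrier G \<rightarrow> (carrier G \<rightarrow> carrier G)"
    and affine_anti_hom:
      "\<lbrakk>a \<in> carrier G; b \<in> carrier G; x \<in> carrier G\<rbrakk> \<Longrightarrow> \<sigma> (a \<otimes> b) x = \<sigma> b (\<sigma> a x)"
    and affine_compat:
      "\<lbrakk>a \<in> carrier G; b \<in> carrier G; c \<in> carrier G\<rbrakk> \<Longrightarrow>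
        \<sigma> a (b \<otimes> \<sigma> b c) = \<sigma> a b \<otimes> \<sigma> (\<sigma> a b) (\<sigma> a c)"

locale cancellative_affine_structure = affine_structure +
  assumes affine_bij: "a \<in> carrier G \<Longrightarrow> bij_betw (\<sigma> a) (carrier G) (carrier G)"

locale groupal_affine_structure = cancellative_affine_structure +
  assumes affine_fixes_one: "a \<in> carrier G \<Longrightarrow> \<sigma> a \<one> = \<one>"

text \<open>The group \<open>G\<close> carries the multiplicative operation; the sum lives on the same carrier.\<close>

locale semi_brace = group G for G (structure) +
  fixes add :: "'a \<Rightarrow> 'a \<Rightarrow> 'a"  (infixl \<open>\<boxplus>\<close> 65)
  assumes add_closed: "\<lbrakk>a \<in> carrier G; b \<in> carrier G\<rbrakk> \<Longrightarrow> a \<boxplus> b \<in> carrier G"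
    and add_assoc:
      "\<lbrakk>a \<in> carrier G; b \<in> carrier G; c \<in> carrier G\<rbrakk> \<Longrightarrow> (a \<boxplus> b) \<boxplus> c = a \<boxplus> (b \<boxplus> c)"
    and brace_distrib:
      "\<lbrakk>a \<in> carrier G; b \<in> carrier G; c \<in> carrier G\<rbrakk> \<Longrightarrow>
        a \<otimes> (b \<boxplus> c) = a \<otimes> b \<boxplus> a \<otimes> (inv a \<boxplus> c)"

locale left_cancellative_semi_brace = semi_brace +
  assumes add_left_cancel:
    "\<lbrakk>a \<in> carrier G; b \<in> carrier G; c \<in> carrier G; a \<boxplus> b = a \<boxplus> c\<rbrakk> \<Longrightarrow> b = c"

text \<open>The neutral element of the additive group is not part of the data, hence the existential.\<close>

locale skew_brace = semi_brace +
  assumes add_group: "\<exists>e. group \<lparr>carrier = carrier G, mult = (\<boxplus>), one = e\<rparr>"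

definition affine_add :: "('a, 'm) monoid_scheme \<Rightarrow> ('a \<Rightarrow> 'a \<Rightarrow> 'a) \<Rightarrow> 'a \<Rightarrow> 'a \<Rightarrow> 'a"
  where "affine_add G \<sigma> a b = a \<otimes>\<^bsub>G\<^esub> \<sigma> a b"

end

theory Submission
  imports Defs
begin

text \<open>Anti-multiplicativity gives
  \<open>\<sigma> (a \<otimes> b) = \<sigma> b \<circ> \<sigma> a\<close>, so associativity of the
  sum is the compatibility axiom multiplied by \<open>a\<close>, and distributivity reduces to
  undoing \<open>\<sigma> (inv a)\<close> (\<open>affine_inv_cancel\<close>). Since \<open>a\<close>
  cancels in the group, each left translation of the sum inherits injectivity and surjectivity from
  \<open>\<sigma> a\<close>. In the groupal case this makes \<open>\<one>\<close> a two-sided zero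
  and provides right inverses, which are then left inverses as well.\<close>

context affine_structure
begin

lemma affine_mem [simp]:
  "\<lbrakk>a \<in> carrier G; b \<in> carrier G\<rbrakk> \<Longrightarrow> \<sigma> a b \<in> carrier G"
  using affine_closed by blast

lemma affine_one_absorb:
  assumes "a \<in> carrier G" "x \<in> carrier G"
  shows "\<sigma> a (\<sigma> \<one> x) = \<sigma> a x"
  using affine_anti_hom[of \<one> a x] assms by simp

text \<open>Applying \<open>\<sigma> (inv a)\<close> and then \<open>\<sigma> a\<close> gives
  \<open>\<sigma> \<one>\<close>. This may differ from the identity, but a following
  \<open>\<sigma> b\<close> absorbs it.\<close>

lemma affine_inv_cancel:
  assumes "a \<in> carrier G" "b \<in> carrier G" "x \<in> carrier G"
  shows "\<sigma> (a \<otimes> b) (\<sigma> (inv a) x) = \<sigma> b x"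
proof -
  have "\<sigma> a (\<sigma> (inv a) x) = \<sigma> \<one> x"
    using affine_anti_hom[of "inv a" a x] assms by simp
  then show ?thesis
    using assms by (simp add: affine_anti_hom affine_one_absorb)
qed

lemma semi_brace_affine_add: "semi_brace G (affine_add G \<sigma>)"
proof unfold_locales
  fix a b c
  assume abc: "a \<in> carrier G" "b \<in> carrier G" "c \<in> carrier G"
  show "affine_add G \<sigma> (affine_add G \<sigma> a b) c = affine_add G \<sigma> a (affine_add G \<sigma> b c)"
    using abc by (simp add: affine_add_def affine_anti_hom affine_compat m_assoc)
  show "a \<otimes> affine_add G \<sigma> b c =
      affine_add G \<sigma> (a \<otimes> b) (a \<otimes> affine_add G \<sigma> (inv a) c)"
    \<comment> \<open>The flipped instance regroups \<open>a \<otimes> (inv a \<otimes> _)\<close>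
      so that \<open>a\<close> cancels, leaving
      \<open>\<sigma> (a \<otimes> b) (\<sigma> (inv a) c)\<close> on the right.\<close>
    using abc by (simp add: affine_add_def affine_inv_cancel m_assoc flip: m_assoc[of a "inv a"])
qed (simp add: affine_add_def)

end

lemma (in cancellative_affine_structure) left_cancellative_semi_brace_affine_add:
  "left_cancellative_semi_brace G (affine_add G \<sigma>)"
proof -
  interpret semi_brace G "affine_add G \<sigma>"
    by (rule semi_brace_affine_add)
  show ?thesis
  proof
    fix a b c
    assume abc: "a \<in> carrier G" "b \<in> carrier G" "c \<in> carrier G"
      and "affine_add G \<sigma> a b = affine_add G \<sigma> a c"
    then have "\<sigma> a b = \<sigma> a c"
      by (simp add: affine_add_def)
    then show "b = c"
      using affine_bij[of a] abc by (auto simp: bij_betw_def dest: inj_onD)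
  qed
qed

context groupal_affine_structure
begin

lemma affine_add_right_one: "a \<in> carrier G \<Longrightarrow> affine_add G \<sigma> a \<one> = a"
  by (simp add: affine_add_def affine_fixes_one)

text \<open>By absorption \<open>\<sigma> \<one>\<close> is idempotent, and an injective idempotent
  map is the identity.\<close>

lemma affine_add_left_one:
  assumes "a \<in> carrier G"
  shows "affine_add G \<sigma> \<one> a = a"
proof -
  have "inj_on (\<sigma> \<one>) (carrier G)"
    using affine_bij[of \<one>] by (simp add: bij_betw_def)
  then have "\<sigma> \<one> a = a"
    using assms affine_one_absorb[of \<one> a] by (auto dest: inj_onD)
  then show ?thesis
    using assms by (simp add: affine_add_def)
qed

text \<open>Solving \<open>a \<otimes> \<sigma> a b = \<one>\<close> for \<open>b\<close> amounts to
  finding a preimage of \<open>inv a\<close> under the surjection \<open>\<sigma> a\<close>.\<close>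

lemma affine_add_right_inverse:
  assumes "a \<in> carrier G"
  obtains b where "b \<in> carrier G" "affine_add G \<sigma> a b = \<one>"
proof -
  have "inv a \<in> \<sigma> a ` carrier G"
    using affine_bij[of a] assms by (simp add: bij_betw_def)
  then obtain b where b: "b \<in> carrier G" "\<sigma> a b = inv a"
    by force
  show ?thesis
    by (rule that[of b]) (use assms b in \<open>simp_all add: affine_add_def\<close>)
qed

lemma skew_brace_affine_add: "skew_brace G (affine_add G \<sigma>)"
proof -
  interpret semi_brace G "affine_add G \<sigma>"
    by (rule semi_brace_affine_add)
  have left_inverse: "\<exists>b \<in> carrier G. affine_add G \<sigma> b a = \<one>" if a: "a \<in> carrier G" for a
  proof -
    obtain b where b: "b \<in> carrier G" "affine_add G \<sigma> a b = \<one>"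
      using a by (rule affine_add_right_inverse)
    obtain c where c: "c \<in> carrier G" "affine_add G \<sigma> b c = \<one>"
      using b(1) by (rule affine_add_right_inverse)
    \<comment> \<open>Associativity evaluates \<open>a + b + c\<close> both as
      \<open>\<one> + c\<close> and as \<open>a + \<one>\<close>. Hence the right inverse
      \<open>c\<close> of \<open>b\<close> is \<open>a\<close> itself, and \<open>b\<close> is a
      left inverse of \<open>a\<close>.\<close>
    have "a = c"
      using add_assoc[OF a b(1) c(1)] a b c
      by (simp add: affine_add_right_one affine_add_left_one)
    with b c show ?thesis
      by blast
  qed
  have "group \<lparr>carrier = carrier G, mult = affine_add G \<sigma>, one = \<one>\<rparr>"
    by (rule groupI) (simp_all add: add_closed add_assoc affine_add_left_one left_inverse)
  then show ?thesis
    by unfold_locales blast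
qed

end

theorem theorem9:
  fixes G :: "('a, 'm) monoid_scheme" and \<sigma> :: "'a \<Rightarrow> 'a \<Rightarrow> 'a"
  assumes "group G"
    and "affine_structure G \<sigma>"
  shows "semi_brace G (affine_add G \<sigma>) \<and>
    (cancellative_affine_structure G \<sigma> \<longrightarrow>
      left_cancellative_semi_brace G (affine_add G \<sigma>)) \<and>
    (groupal_affine_structure G \<sigma> \<longrightarrow> skew_brace G (affine_add G \<sigma>))"
  using affine_structure.semi_brace_affine_add[OF assms(2)]
    cancellative_affine_structure.left_cancellative_semi_brace_affine_add
    groupal_affine_structure.skew_brace_affine_add
  by blast

end
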